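(* Let $f=\sum_{i=1}^m f_i$ with $f_i:\mathbb{R}^d\to\mathbb{R}$. Assume that: (i) each $f_i$ is convex and has $L$-Lipschitz continuous gradient, i.e. $f_i(x)+\langle\nabla f_i(x),y-x\rangle\le f_i(y)\le f_i(x)+\langle\nabla f_i(x),y-x\rangle+\frac L2\|y-x\|^2$ for all $x,y\in\mathbb{R}^d$; (ii) $f$ is $\mu$-strongly convex with $\mu>0$; (iii) $f_i(x)=\ell(a_i^Tx,b_i)$ with $a_i\in\mathbb{R}^d$, $b_i\in\mathbb{R}$, and $\mathrm{supp}(\nabla f_i(x))=\mathrm{supp}(a_i)$ for every $x$ and $i$. Let $\Delta=\min(\Delta_{\rm ave},\Delta_{\max})$ and $\bar L=L\sqrt{m(1+\Delta)}$. Let $Q$ be an unbiased random quantizer with variance parameter $\alpha$. Let the delays satisfy $\tau_k^i\le\tau$ for all $i,k$, and suppose $0<\gamma<\bar\gamma$ where $$\bar\gamma=\min\left(\frac{\mu}{\sqrt\alpha\,\tau\bar L^2},\frac1{\alpha\bar L}\right).$$ Then the iterates generated by $$x_{k+1}=x_k-\gamma\,Q\Big(\sum_{i=1}^m\nabla f_i(x_{k-\tau_k^i})\Big)$$ satisfy, for all $k\in\mathbb{N}$, $$\mathbf{E}[f(x_k)-f(x^\star)]\le(p+q)^{k/(1+2\tau)}\big(f(x_0)-f(x^\star)\big),$$ where $p=1-\mu\gamma$ and $q=\bar L^4\gamma^3\tau^2\alpha/\mu$.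
   Context: $\|\cdot\|$ is the Euclidean norm and $\mathrm{supp}(x)=\{i: x^i\ne0\}$. $x^\star$ is the minimizer of $f$. $x_0\in\mathbb{R}^d$ is a deterministic initial point. The delays $\tau_k^i$ are nonnegative integers, $\tau$ is a nonnegative integer, and $x_k:=x_0$ for $k<0$. For $\tau=0$ the first term in the minimum is read as $+\infty$. Conflict graph degrees: $\Delta_{\rm ave}=\frac1m\sum_{i=1}^m\sum_{j\ne i}\mathbf 1\{\mathrm{supp}(a_i)\cap\mathrm{supp}(a_j)\ne\emptyset\}$ and $\Delta_{\max}=\max_{i}\sum_{j\ne i}\mathbf 1\{\mathrm{supp}(a_i)\cap\mathrm{supp}(a_j)\ne\emptyset\}$. An unbiased random quantizer (URQ) with parameter $\alpha$ (finite, positive) is a random mapping $Q:\mathbb{R}^d\to\mathbb{R}^d$ such that for every $v\in\mathbb{R}^d$: $\mathrm{supp}(Q(v))\subseteq\mathrm{supp}(v)$, $\mathbf{E}\{Q(v)\}=v$, and $\mathbf{E}\{\|Q(v)\|^2\}\le\alpha\|v\|^2$. Each application of $Q$ in the algorithm uses fresh randomness, so these properties hold conditionally on the past iterates. *)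

theory Defs
  imports "HOL-Probability.Probability"
begin

definition supp :: "real ^ 'd \<Rightarrow> 'd set" where
  "supp v = {i. v $ i \<noteq> 0}"

definition strongly_convex_on :: "'a::real_inner set \<Rightarrow> real \<Rightarrow> ('a \<Rightarrow> real) \<Rightarrow> bool" where
  "strongly_convex_on S \<mu> f \<longleftrightarrow> convex S \<and>
     (\<forall>x\<in>S. \<forall>y\<in>S. \<forall>t\<in>{0..1}.
        f ((1 - t) *\<^sub>R x + t *\<^sub>R y)
          \<le> (1 - t) * f x + t * f y - \<mu> / 2 * t * (1 - t) * (norm (x - y))\<^sup>2)"

definition conflict_degree :: "('m::finite \<Rightarrow> real ^ 'd) \<Rightarrow> 'm \<Rightarrow> nat" where
  "conflict_degree a i = card {j. j \<noteq> i \<and> supp (a i) \<inter> supp (a j) \<noteq> {}}"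

definition conflict_ave :: "('m::finite \<Rightarrow> real ^ 'd) \<Rightarrow> real" where
  "conflict_ave a = (\<Sum>i\<in>UNIV. real (conflict_degree a i)) / real CARD('m)"

definition conflict_max :: "('m::finite \<Rightarrow> real ^ 'd) \<Rightarrow> nat" where
  "conflict_max a = Max (range (conflict_degree a))"

text \<open>
  The random mapping is driven by an abstract noise space \<open>N\<close>: a draw \<open>s\<close> gives the mapping
  \<open>Q s\<close>. Joint measurability in \<open>(s, v)\<close> makes \<open>Q\<close> applicable to a random argument.
  The integrability clauses are needed because the Bochner integral of a non-integrable
  function is \<open>0\<close>.
\<close>

definition unbiased_random_quantizer ::
    "'s measure \<Rightarrow> ('s \<Rightarrow> real ^ 'd \<Rightarrow> real ^ 'd) \<Rightarrow> real \<Rightarrow> bool" where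
  "unbiased_random_quantizer N Q \<alpha> \<longleftrightarrow>
     prob_space N \<and> 0 < \<alpha> \<and>
     (\<lambda>(s, v). Q s v) \<in> borel_measurable (N \<Otimes>\<^sub>M borel) \<and>
     (\<forall>v. (AE s in N. supp (Q s v) \<subseteq> supp v) \<and>
          integrable N (\<lambda>s. Q s v) \<and>
          (\<integral>s. Q s v \<partial>N) = v \<and>
          integrable N (\<lambda>s. (norm (Q s v))\<^sup>2) \<and>
          (\<integral>s. (norm (Q s v))\<^sup>2 \<partial>N) \<le> \<alpha> * (norm v)\<^sup>2)"

text \<open>
  For \<open>\<tau> = 0\<close> the first term of the minimum stands for \<open>+\<infinity>\<close>, whereas HOL division
  would give \<open>0\<close>; hence the case distinction.
\<close>

definition max_step :: "real \<Rightarrow> real \<Rightarrow> real \<Rightarrow> nat \<Rightarrow> real" where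
  "max_step \<mu> \<alpha> Lbar \<tau> =
     (if \<tau> = 0 then 1 / (\<alpha> * Lbar)
      else min (\<mu> / (sqrt \<alpha> * real \<tau> * Lbar\<^sup>2)) (1 / (\<alpha> * Lbar)))"

text \<open>
  The step driven by the noise \<open>\<xi> k\<close> is taken with delays \<open>delay k i\<close>. Truncated subtraction
  on \<open>nat\<close> yields \<open>x (k - delay k i) = x 0\<close> whenever \<open>delay k i > k\<close>, which is the convention
  that iterates with negative index equal the initial point.
\<close>

definition delayed_quantized_gradient_iterates ::
    "'w measure \<Rightarrow> ('s \<Rightarrow> real ^ 'd \<Rightarrow> real ^ 'd) \<Rightarrow> (nat \<Rightarrow> 'w \<Rightarrow> 's) \<Rightarrow>
     ('m::finite \<Rightarrow> real ^ 'd \<Rightarrow> real ^ 'd) \<Rightarrow> (nat \<Rightarrow> 'm \<Rightarrow> nat) \<Rightarrow> real \<Rightarrow>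
     real ^ 'd \<Rightarrow> (nat \<Rightarrow> 'w \<Rightarrow> real ^ 'd) \<Rightarrow> bool" where
  "delayed_quantized_gradient_iterates M Q \<xi> grad delay \<gamma> x0 x \<longleftrightarrow>
     (\<forall>\<omega>\<in>space M. x 0 \<omega> = x0) \<and>
     (\<forall>k. \<forall>\<omega>\<in>space M.
        x (Suc k) \<omega> =
          x k \<omega> - \<gamma> *\<^sub>R Q (\<xi> k \<omega>) (\<Sum>i\<in>UNIV. grad i (x (k - delay k i) \<omega>)))"

end

theory Submission
  imports Defs
begin

text \<open>
  In expectation, one step is a gradient step with a stale gradient. Write \<open>V k\<close> for the
  expected gap \<open>E (F (x k) - F xstar)\<close>, \<open>g k\<close> for the delayed gradient that is fed to the quantizer,
  and \<open>\<Lambda>\<close> for the constant \<open>Lbar\<close>, which is a Lipschitz constant of the full gradient. The descent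
  inequality for \<open>\<Lambda>\<close>-smooth functions, unbiasedness of \<open>Q\<close>, its second moment bound and
  \<open>\<gamma> \<alpha> \<Lambda> \<le> 1\<close> give
  \<open>V (k + 1) \<le> V k - \<gamma>/2 E |grad F (x k)|\<^sup>2 + \<gamma>/2 E |grad F (x k) - g k|\<^sup>2\<close>.
  Strong convexity turns the middle term into the contraction \<open>p = 1 - \<mu> \<gamma>\<close>.

  The last term measures how far the iterates drift during at most \<open>\<tau>\<close> steps. Each increment is a
  quantized delayed gradient, and a delayed gradient is controlled by the distance to the
  minimizer of iterates that are again up to \<open>\<tau>\<close> steps old. So the last term is at most \<open>q\<close> times the
  largest \<open>V j\<close> with \<open>j\<close> among the last \<open>2 \<tau>\<close> indices or \<open>j = k\<close>
  (\<open>expectation_staleness_sq_le\<close>, \<open>gap_Suc_le\<close>).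
  A sequence with \<open>V (k + 1) \<le> p V k + q max V j\<close> over a window of \<open>n\<close> past indices decays like
  \<open>(p + q) ^ (k / (1 + n))\<close> (\<open>delayed_linear_recursion\<close>), here with \<open>n = 2 \<tau>\<close>.

  The delays differ from component to component, and this needs care: bounding a sum of
  stale components by the worst delay would leave the expectation of a maximum over iterates, which
  the numbers \<open>V j\<close> do not control. This is avoided by a bound that is linear in the individual
  squared displacements, with weights \<open>w i = L\<^sup>2 (1 + degree of i)\<close>. Two gradients with disjoint supports
  are orthogonal, so \<open>|\<Sum> v i|\<^sup>2 \<le> \<Sum> (1 + degree of i) |v i|\<^sup>2\<close> (\<open>norm_sum_sq_le_conflict\<close>).
  Expectations can then be taken term by term, and the weights add up to
  \<open>L\<^sup>2 m (1 + conflict_ave) = \<Lambda>\<^sup>2\<close>; the average degree never exceeds the maximal one, so \<open>\<Delta>\<close> is the average.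

  On the probabilistic side, the iterates up to time \<open>k\<close> are measurable with respect to the noises
  \<open>\<xi> 0, \<dots>, \<xi> (k - 1)\<close>, of which \<open>\<xi> k\<close> is independent. Fubini's theorem for the joint law of the
  past and \<open>\<xi> k\<close> replaces conditional expectations.
\<close>

section \<open>Sums of vectors with sparse overlaps\<close>

lemma inner_eq_0_if_supp_disjoint:
  assumes "supp u \<inter> supp v = {}"
  shows "u \<bullet> v = 0"
  using assms by (force simp: inner_vec_def supp_def intro!: sum.neutral)

text \<open>
  Expand the square. Pairs with disjoint supports contribute nothing, and any other pair contributes
  at most \<open>(|v i|\<^sup>2 + |v j|\<^sup>2) / 2\<close>. The conflict relation is symmetric, so \<open>|v i|\<^sup>2\<close> is counted once
  for \<open>i\<close> itself and once for each of its neighbours.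
\<close>

lemma norm_sum_sq_le_conflict:
  fixes a v :: "'m::finite \<Rightarrow> real ^ 'd"
  assumes supp: "\<And>i. supp (v i) \<subseteq> supp (a i)"
  shows "(norm (\<Sum>i\<in>UNIV. v i))\<^sup>2 \<le> (\<Sum>i\<in>UNIV. (1 + real (conflict_degree a i)) * (norm (v i))\<^sup>2)"
proof -
  define c where "c i j = (of_bool (j = i \<or> supp (a i) \<inter> supp (a j) \<noteq> {}) :: real)" for i j
  have c_sym: "c i j = c j i" for i j
    by (auto simp: c_def)
  have row: "(\<Sum>j\<in>UNIV. c i j) = 1 + real (conflict_degree a i)" for i
  proof -
    have "(\<Sum>j\<in>UNIV. c i j) = real (card {j. j = i \<or> supp (a i) \<inter> supp (a j) \<noteq> {}})"
      by (simp add: c_def sum.If_cases of_bool_def)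
    also have "{j. j = i \<or> supp (a i) \<inter> supp (a j) \<noteq> {}}
        = insert i {j. j \<noteq> i \<and> supp (a i) \<inter> supp (a j) \<noteq> {}}"
      by auto
    finally show ?thesis
      by (simp add: conflict_degree_def)
  qed
  have pair: "v i \<bullet> v j \<le> c i j * (norm (v i))\<^sup>2 / 2 + c i j * (norm (v j))\<^sup>2 / 2" for i j
  proof (cases "supp (a i) \<inter> supp (a j) = {} \<and> j \<noteq> i")
    case True
    then have "v i \<bullet> v j = 0"
      using supp[of i] supp[of j] by (intro inner_eq_0_if_supp_disjoint) blast
    then show ?thesis
      by (simp add: c_def)
  next
    case False
    then have "c i j = 1"
      by (auto simp: c_def)
    moreover have "0 \<le> (norm (v i - v j))\<^sup>2"
      by simp
    ultimately show ?thesis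
      by (simp add: power2_norm_eq_inner inner_diff_left inner_diff_right inner_commute)
  qed
  have "(norm (\<Sum>i\<in>UNIV. v i))\<^sup>2 = (\<Sum>i\<in>UNIV. \<Sum>j\<in>UNIV. v i \<bullet> v j)"
    by (simp add: power2_norm_eq_inner inner_sum_left inner_sum_right)
      (rule sum.swap)
  also have "\<dots> \<le> (\<Sum>i\<in>UNIV. \<Sum>j\<in>UNIV. c i j * (norm (v i))\<^sup>2 / 2 + c i j * (norm (v j))\<^sup>2 / 2)"
    by (intro sum_mono pair)
  also have "\<dots> = (\<Sum>i\<in>UNIV. \<Sum>j\<in>UNIV. c i j * (norm (v i))\<^sup>2 / 2)
      + (\<Sum>j\<in>UNIV. \<Sum>i\<in>UNIV. c i j * (norm (v j))\<^sup>2 / 2)"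
    unfolding sum.distrib by (subst (2) sum.swap) simp
  also have "\<dots> = (\<Sum>i\<in>UNIV. \<Sum>j\<in>UNIV. c i j * (norm (v i))\<^sup>2)"
    unfolding sum_divide_distrib[symmetric] by (subst (2) c_sym) simp
  also have "\<dots> = (\<Sum>i\<in>UNIV. (1 + real (conflict_degree a i)) * (norm (v i))\<^sup>2)"
    by (simp add: sum_distrib_right[symmetric] row)
  finally show ?thesis .
qed

lemma sum_conflict_degree:
  fixes a :: "'m::finite \<Rightarrow> real ^ 'd"
  shows "(\<Sum>i\<in>UNIV. 1 + real (conflict_degree a i)) = real CARD('m) * (1 + conflict_ave a)"
  by (simp add: conflict_ave_def sum.distrib field_simps)

lemma conflict_ave_le_max:
  fixes a :: "'m::finite \<Rightarrow> real ^ 'd"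
  shows "conflict_ave a \<le> real (conflict_max a)"
proof -
  have "(\<Sum>i\<in>UNIV. real (conflict_degree a i)) \<le> (\<Sum>i\<in>(UNIV::'m set). real (conflict_max a))"
    by (intro sum_mono) (simp add: conflict_max_def)
  then show ?thesis
    by (simp add: conflict_ave_def field_simps)
qed

section \<open>Sequences: a delayed linear recursion and sums of increments\<close>

text \<open>
  Put \<open>r t = (p + q) powr (t / (1 + n))\<close>, which does not increase with \<open>t\<close>. If \<open>V j \<le> r j V 0\<close> up to
  index \<open>l\<close>, all values in the window are at most \<open>r (l - n) V 0\<close>; hence
  \<open>V (l + 1) \<le> (p + q) r (l - n) V 0\<close>, and the exponent is chosen such that \<open>p + q = r (1 + n)\<close>. The window hypothesis is stated with an arbitrary
  upper bound \<open>W\<close> instead of a maximum.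
\<close>

lemma delayed_linear_recursion:
  fixes V :: "nat \<Rightarrow> real"
  assumes nonneg: "0 \<le> p" "0 \<le> q" "0 \<le> V 0"
    and contract: "0 < p + q" "p + q \<le> 1"
    and rec: "\<And>k W. (\<And>j. k - n \<le> j \<Longrightarrow> j \<le> k \<Longrightarrow> V j \<le> W) \<Longrightarrow> V (Suc k) \<le> p * V k + q * W"
  shows "V k \<le> (p + q) powr (real k / (1 + real n)) * V 0"
proof (induction k rule: less_induct)
  case (less k)
  \<comment> \<open>Real exponents, since \<open>l - n\<close> below may be negative.\<close>
  define r where "r = (\<lambda>t. (p + q) powr (t / (1 + real n)))"
  have r_antimono: "r t \<le> r s" if "s \<le> t" for s t
    unfolding r_def using contract that by (intro powr_mono') (auto simp: divide_right_mono)
  show ?case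
  proof (cases k)
    case 0
    then show ?thesis
      using contract by simp
  next
    case (Suc l)
    have IH: "V j \<le> r (real j) * V 0" if "j \<le> l" for j
      using less[of j] that Suc by (simp add: r_def)
    have window: "V j \<le> r (real l - real n) * V 0" if "l - n \<le> j" "j \<le> l" for j
    proof -
      have "r (real j) * V 0 \<le> r (real l - real n) * V 0"
        using that nonneg by (intro mult_right_mono r_antimono) auto
      then show ?thesis
        using IH[OF that(2)] by linarith
    qed
    have "V (Suc l) \<le> p * V l + q * (r (real l - real n) * V 0)"
      by (rule rec) (rule window)
    also have "\<dots> \<le> p * (r (real l - real n) * V 0) + q * (r (real l - real n) * V 0)"
      using nonneg window[of l] by (intro add_right_mono mult_left_mono) auto
    also have "\<dots> = (p + q) powr 1 * r (real l - real n) * V 0"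
      using contract by (simp add: algebra_simps)
    also have "(p + q) powr 1 * r (real l - real n) = r (real (Suc l))"
      unfolding r_def powr_add[symmetric] by (rule arg_cong[where f = "(powr) (p + q)"]) (simp add: field_simps)
    finally show ?thesis
      by (simp add: Suc r_def)
  qed
qed

text \<open>Telescoping followed by the Cauchy-Schwarz inequality against the constant sequence 1.\<close>

lemma norm_diff_sq_le_sum_increments:
  fixes z :: "nat \<Rightarrow> 'a::real_inner"
  assumes "j \<le> k"
  shows "(norm (z k - z j))\<^sup>2 \<le> real (k - j) * (\<Sum>l\<in>{j..<k}. (norm (z (Suc l) - z l))\<^sup>2)"
proof -
  have "z k - z j = (\<Sum>l\<in>{j..<k}. z (Suc l) - z l)"
    using assms by (simp add: sum_Suc_diff')
  then have "norm (z k - z j) \<le> (\<Sum>l\<in>{j..<k}. norm (z (Suc l) - z l))"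
    by (simp add: norm_sum)
  then have "(norm (z k - z j))\<^sup>2 \<le> (\<Sum>l\<in>{j..<k}. norm (z (Suc l) - z l))\<^sup>2"
    by (intro power_mono) auto
  also have "\<dots> \<le> (\<Sum>l\<in>{j..<k}. 1\<^sup>2) * (\<Sum>l\<in>{j..<k}. (norm (z (Suc l) - z l))\<^sup>2)"
    using Cauchy_Schwarz_ineq_sum[of "\<lambda>_. 1" "\<lambda>l. norm (z (Suc l) - z l)" "{j..<k}"] by simp
  finally show ?thesis
    by simp
qed

section \<open>Strongly convex objectives with component-wise smooth gradients\<close>

text \<open>
  What the analysis uses about the objective. The assumption \<open>weighted_lipschitz\<close> lets every component
  be evaluated at points of its own; it is linear in the squared displacements, so it survives taking
  expectations. Taking the same pair of points for all components shows that \<open>\<Lambda>\<close> is a Lipschitz constant of the full gradient.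
\<close>

locale weighted_smooth_objective =
  fixes F :: "'a::euclidean_space \<Rightarrow> real"
    and grad :: "'m::finite \<Rightarrow> 'a \<Rightarrow> 'a"
    and w :: "'m \<Rightarrow> real"
    and \<Lambda> \<mu> :: real
    and xstar :: 'a
  assumes gradient: "GDERIV F y :> (\<Sum>i\<in>UNIV. grad i y)"
    and weighted_lipschitz:
      "(norm ((\<Sum>i\<in>UNIV. grad i (u i)) - (\<Sum>i\<in>UNIV. grad i (v i))))\<^sup>2
        \<le> (\<Sum>i\<in>UNIV. w i * (norm (u i - v i))\<^sup>2)"
    and w_nonneg: "0 \<le> w i"
    and sum_w: "(\<Sum>i\<in>UNIV. w i) = \<Lambda>\<^sup>2"
    and \<Lambda>_pos: "0 < \<Lambda>"
    and continuous_grad: "continuous_on UNIV (grad i)"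
    and lower: "F y + (\<Sum>i\<in>UNIV. grad i y) \<bullet> (z - y) \<le> F z"
    and strong: "strongly_convex_on UNIV \<mu> F"
    and \<mu>_pos: "0 < \<mu>"
    and minimal: "F xstar \<le> F y"
begin

definition gradF :: "'a \<Rightarrow> 'a" where
  "gradF y = (\<Sum>i\<in>UNIV. grad i y)"

lemma gradient_gradF: "GDERIV F y :> gradF y"
  using gradient by (simp add: gradF_def)

lemma gradF_lipschitz: "norm (gradF y - gradF z) \<le> \<Lambda> * norm (y - z)"
proof -
  have "(norm (gradF y - gradF z))\<^sup>2 \<le> (\<Sum>i\<in>UNIV. w i * (norm (y - z))\<^sup>2)"
    using weighted_lipschitz[of "\<lambda>_. y" "\<lambda>_. z"] by (simp only: gradF_def)
  also have "\<dots> = (\<Lambda> * norm (y - z))\<^sup>2"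
    by (simp only: sum_distrib_right[symmetric] sum_w power_mult_distrib)
  finally show ?thesis
    by (rule power2_le_imp_le) (simp add: less_imp_le[OF \<Lambda>_pos])
qed

text \<open>
  The derivative along the segment from \<open>y\<close> to \<open>y + v\<close> exceeds its initial value by at most
  \<open>\<Lambda> t |v|\<^sup>2\<close> at time \<open>t\<close>.
\<close>

lemma descent: "F (y + v) \<le> F y + gradF y \<bullet> v + \<Lambda> / 2 * (norm v)\<^sup>2"
proof -
  define \<psi> where "\<psi> t = F (y + t *\<^sub>R v) - t * (gradF y \<bullet> v) - \<Lambda> / 2 * t\<^sup>2 * (norm v)\<^sup>2" for t
  have "\<psi> 1 \<le> \<psi> 0"
  proof (rule DERIV_nonpos_imp_nonincreasing[of 0 1 \<psi>])
    fix t :: real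
    assume t: "0 \<le> t"
    have "((\<lambda>t. F (y + t *\<^sub>R v)) has_derivative (\<lambda>h. (h *\<^sub>R v) \<bullet> gradF (y + t *\<^sub>R v))) (at t)"
    proof (rule has_derivative_compose[where g = F])
      show "((\<lambda>t. y + t *\<^sub>R v) has_derivative (\<lambda>h. h *\<^sub>R v)) (at t)"
        by (auto intro!: derivative_eq_intros)
      show "(F has_derivative (\<lambda>h. h \<bullet> gradF (y + t *\<^sub>R v))) (at (y + t *\<^sub>R v))"
        using gradient_gradF by (simp add: gderiv_def)
    qed
    then have "((\<lambda>t. F (y + t *\<^sub>R v)) has_real_derivative gradF (y + t *\<^sub>R v) \<bullet> v) (at t)"
      by (rule has_derivative_imp_has_field_derivative) (simp add: inner_commute)
    moreover have "((\<lambda>t. t * (gradF y \<bullet> v)) has_real_derivative gradF y \<bullet> v) (at t)"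
      by (auto intro!: derivative_eq_intros)
    moreover have "((\<lambda>t. \<Lambda> / 2 * t\<^sup>2 * (norm v)\<^sup>2) has_real_derivative \<Lambda> * t * (norm v)\<^sup>2) (at t)"
      by (auto intro!: derivative_eq_intros)
    ultimately have "(\<psi> has_real_derivative
        (gradF (y + t *\<^sub>R v) - gradF y) \<bullet> v - \<Lambda> * t * (norm v)\<^sup>2) (at t)"
      unfolding \<psi>_def inner_diff_left by (intro DERIV_diff)
    moreover have "(gradF (y + t *\<^sub>R v) - gradF y) \<bullet> v \<le> \<Lambda> * t * (norm v)\<^sup>2"
    proof -
      have "(gradF (y + t *\<^sub>R v) - gradF y) \<bullet> v \<le> norm (gradF (y + t *\<^sub>R v) - gradF y) * norm v"
        by (rule norm_cauchy_schwarz)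
      also have "\<dots> \<le> (\<Lambda> * norm (y + t *\<^sub>R v - y)) * norm v"
        by (intro mult_right_mono gradF_lipschitz) auto
      finally show ?thesis
        using t by (simp add: power2_eq_square mult_ac)
    qed
    ultimately show "\<exists>d. (\<psi> has_real_derivative d) (at t) \<and> d \<le> 0"
      by (intro exI[of _ "(gradF (y + t *\<^sub>R v) - gradF y) \<bullet> v - \<Lambda> * t * (norm v)\<^sup>2"]) simp
  qed simp
  then show ?thesis
    by (simp add: \<psi>_def)
qed

text \<open>A step of length \<open>1 / \<Lambda>\<close> from the minimizer would otherwise decrease \<open>F\<close>.\<close>

lemma gradF_xstar: "gradF xstar = 0"
proof -
  have "F xstar \<le> F (xstar + (- (1 / \<Lambda>)) *\<^sub>R gradF xstar)"
    by (rule minimal)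
  also have "\<dots> \<le> F xstar - (norm (gradF xstar))\<^sup>2 / (2 * \<Lambda>)"
    using descent[of xstar "(- (1 / \<Lambda>)) *\<^sub>R gradF xstar"] \<Lambda>_pos
    by (simp add: power_divide power2_norm_eq_inner[symmetric])
      (simp add: power2_eq_square field_simps)
  finally have "(norm (gradF xstar))\<^sup>2 \<le> 0"
    using \<Lambda>_pos by (simp add: field_simps)
  then show ?thesis
    by simp
qed

lemma gap_le: "F y - F xstar \<le> \<Lambda> / 2 * (norm (y - xstar))\<^sup>2"
  using descent[of xstar "y - xstar"] by (simp add: gradF_xstar)

text \<open>
  Compare the linear lower bound at the point \<open>(1 - t) y + t z\<close> with the strong convexity upper
  bound there, divide by \<open>t\<close> and let \<open>t\<close> tend to 0.
\<close>

lemma strong_lower: "F y + gradF y \<bullet> (z - y) + \<mu> / 2 * (norm (z - y))\<^sup>2 \<le> F z"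
proof -
  have "(1 - t) * (\<mu> / 2 * (norm (z - y))\<^sup>2) \<le> F z - F y - gradF y \<bullet> (z - y)" if "0 < t" "t < 1" for t
  proof -
    have "F y + t * (gradF y \<bullet> (z - y)) \<le> F ((1 - t) *\<^sub>R y + t *\<^sub>R z)"
    proof -
      have "(1 - t) *\<^sub>R y + t *\<^sub>R z - y = t *\<^sub>R (z - y)"
        by (simp add: algebra_simps)
      then show ?thesis
        using lower[of y "(1 - t) *\<^sub>R y + t *\<^sub>R z"] by (simp add: gradF_def)
    qed
    also have "\<dots> \<le> (1 - t) * F y + t * F z - \<mu> / 2 * t * (1 - t) * (norm (y - z))\<^sup>2"
      using strong that by (auto simp: strongly_convex_on_def)
    finally have "t * ((1 - t) * (\<mu> / 2 * (norm (z - y))\<^sup>2)) \<le> t * (F z - F y - gradF y \<bullet> (z - y))"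
      by (simp add: algebra_simps norm_minus_commute)
    then show ?thesis
      using that by simp
  qed
  then have "\<forall>\<^sub>F t in at_right 0. (1 - t) * (\<mu> / 2 * (norm (z - y))\<^sup>2) \<le> F z - F y - gradF y \<bullet> (z - y)"
    unfolding eventually_at_right_field by (intro exI[of _ 1]) auto
  moreover have "((\<lambda>t. (1 - t) * (\<mu> / 2 * (norm (z - y))\<^sup>2)) \<longlongrightarrow> (1 - 0) * (\<mu> / 2 * (norm (z - y))\<^sup>2)) (at_right 0)"
    by (intro tendsto_intros)
  ultimately have "(1 - 0) * (\<mu> / 2 * (norm (z - y))\<^sup>2) \<le> F z - F y - gradF y \<bullet> (z - y)"
    by (intro tendsto_upperbound[where F = "at_right (0::real)"]) auto
  then show ?thesis
    by simp
qed

lemma quadratic_growth: "\<mu> / 2 * (norm (y - xstar))\<^sup>2 \<le> F y - F xstar"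
  using strong_lower[of xstar y] by (simp add: gradF_xstar)

text \<open>
  The Polyak-Lojasiewicz inequality: minimize the left-hand side of \<open>strong_lower\<close> over \<open>z\<close>, which
  here takes the form of the completed square \<open>|grad F y + \<mu> (xstar - y)|\<^sup>2 \<ge> 0\<close>.
\<close>

lemma gradient_dominance: "2 * \<mu> * (F y - F xstar) \<le> (norm (gradF y))\<^sup>2"
proof -
  have square: "(norm (u + \<mu> *\<^sub>R v))\<^sup>2 = (norm u)\<^sup>2 + 2 * \<mu> * (u \<bullet> v + \<mu> / 2 * (norm v)\<^sup>2)" for u v :: 'a
    unfolding power2_norm_eq_inner by (simp add: inner_commute algebra_simps)
  have "0 \<le> (norm (gradF y + \<mu> *\<^sub>R (xstar - y)))\<^sup>2"
    by simp
  also have "\<dots> = (norm (gradF y))\<^sup>2 + 2 * \<mu> * (gradF y \<bullet> (xstar - y) + \<mu> / 2 * (norm (xstar - y))\<^sup>2)"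
    by (rule square)
  also have "\<dots> \<le> (norm (gradF y))\<^sup>2 + 2 * \<mu> * (F xstar - F y)"
    using strong_lower[of y xstar] \<mu>_pos by (intro add_left_mono mult_left_mono) auto
  finally show ?thesis
    by (simp add: algebra_simps)
qed

text \<open>
  The gap lies between two quadratics with curvatures \<open>\<mu>\<close> and \<open>\<Lambda>\<close>; one point other than the minimizer
  suffices to compare them. Together with \<open>\<alpha> \<ge> 1\<close> this makes \<open>p\<close> positive for admissible step sizes.
\<close>

lemma \<mu>_le_\<Lambda>: "\<mu> \<le> \<Lambda>"
proof -
  obtain e :: 'a where "e \<in> Basis"
    using nonempty_Basis by blast
  then show ?thesis
    using quadratic_growth[of "xstar + e"] gap_le[of "xstar + e"] by simp
qed

end

section \<open>Fresh noise\<close>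

text \<open>
  Independence is expressed by the joint law because \<open>X\<close> and \<open>Y\<close> take values in different types.
\<close>

lemma (in prob_space)
  assumes X[measurable]: "X \<in> M \<rightarrow>\<^sub>M S" and Y[measurable]: "Y \<in> M \<rightarrow>\<^sub>M N"
    and joint: "distr M (S \<Otimes>\<^sub>M N) (\<lambda>\<omega>. (X \<omega>, Y \<omega>)) = distr M S X \<Otimes>\<^sub>M N"
    and N: "prob_space N"
    and h[measurable]: "case_prod h \<in> borel_measurable (S \<Otimes>\<^sub>M N)"
  shows nn_integral_product_joint: "(\<integral>\<^sup>+\<omega>. ennreal (h (X \<omega>) (Y \<omega>)) \<partial>M) = (\<integral>\<^sup>+\<omega>. \<integral>\<^sup>+s. ennreal (h (X \<omega>) s) \<partial>N \<partial>M)"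
    and expectation_product_joint: "integrable M (\<lambda>\<omega>. h (X \<omega>) (Y \<omega>)) \<Longrightarrow>
      (\<integral>\<omega>. h (X \<omega>) (Y \<omega>) \<partial>M) = (\<integral>\<omega>. \<integral>s. (h (X \<omega>) s :: real) \<partial>N \<partial>M)"
proof -
  interpret X: prob_space "distr M S X"
    by (rule prob_space_distr) simp
  interpret N: prob_space N
    by (rule N)
  interpret J: pair_prob_space "distr M S X" N ..
  have "(\<integral>\<^sup>+\<omega>. ennreal (h (X \<omega>) (Y \<omega>)) \<partial>M) = (\<integral>\<^sup>+z. ennreal (case_prod h z) \<partial>distr M (S \<Otimes>\<^sub>M N) (\<lambda>\<omega>. (X \<omega>, Y \<omega>)))"
    by (subst nn_integral_distr) auto
  also have "\<dots> = (\<integral>\<^sup>+y. \<integral>\<^sup>+s. ennreal (h y s) \<partial>N \<partial>distr M S X)"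
    unfolding joint by (subst N.nn_integral_fst[symmetric]) auto
  also have "\<dots> = (\<integral>\<^sup>+\<omega>. \<integral>\<^sup>+s. ennreal (h (X \<omega>) s) \<partial>N \<partial>M)"
    by (subst nn_integral_distr) auto
  finally show "(\<integral>\<^sup>+\<omega>. ennreal (h (X \<omega>) (Y \<omega>)) \<partial>M) = (\<integral>\<^sup>+\<omega>. \<integral>\<^sup>+s. ennreal (h (X \<omega>) s) \<partial>N \<partial>M)" .
  assume int: "integrable M (\<lambda>\<omega>. h (X \<omega>) (Y \<omega>))"
  have "integrable (distr M (S \<Otimes>\<^sub>M N) (\<lambda>\<omega>. (X \<omega>, Y \<omega>))) (case_prod h)"
    using int by (subst integrable_distr_eq) auto
  then have "integrable (distr M S X \<Otimes>\<^sub>M N) (case_prod h)"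
    by (simp add: joint)
  then have fubini: "(\<integral>y. \<integral>s. h y s \<partial>N \<partial>distr M S X) = integral\<^sup>L (distr M S X \<Otimes>\<^sub>M N) (case_prod h)"
    using J.integral_fst' by fastforce
  have "(\<integral>\<omega>. h (X \<omega>) (Y \<omega>) \<partial>M) = integral\<^sup>L (distr M (S \<Otimes>\<^sub>M N) (\<lambda>\<omega>. (X \<omega>, Y \<omega>))) (case_prod h)"
    by (subst integral_distr) auto
  also have "\<dots> = (\<integral>y. \<integral>s. h y s \<partial>N \<partial>distr M S X)"
    by (simp only: joint fubini)
  also have "\<dots> = (\<integral>\<omega>. \<integral>s. h (X \<omega>) s \<partial>N \<partial>M)"
    by (subst integral_distr) auto
  finally show "(\<integral>\<omega>. h (X \<omega>) (Y \<omega>) \<partial>M) = (\<integral>\<omega>. \<integral>s. h (X \<omega>) s \<partial>N \<partial>M)" .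
qed


section \<open>The iteration and its moments\<close>

locale delayed_quantized_descent =
  weighted_smooth_objective F grad w \<Lambda> \<mu> xstar + prob_space M
  for F :: "real ^ 'd \<Rightarrow> real"
    and grad :: "'m::finite \<Rightarrow> real ^ 'd \<Rightarrow> real ^ 'd"
    and w \<Lambda> \<mu> xstar
    and M :: "'w measure" +
  fixes N :: "'s measure"
    and Q :: "'s \<Rightarrow> real ^ 'd \<Rightarrow> real ^ 'd"
    and \<xi> :: "nat \<Rightarrow> 'w \<Rightarrow> 's"
    and \<alpha> \<gamma> :: real
    and \<tau> :: nat
    and delay :: "nat \<Rightarrow> 'm \<Rightarrow> nat"
    and x0 :: "real ^ 'd"
    and x :: "nat \<Rightarrow> 'w \<Rightarrow> real ^ 'd"
  assumes quantizer: "unbiased_random_quantizer N Q \<alpha>"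
    and noise_indep: "indep_vars (\<lambda>_. N) \<xi> UNIV"
    and noise_distr: "distr M N (\<xi> j) = N"
    and delays: "delay j i \<le> \<tau>"
    and \<gamma>_pos: "0 < \<gamma>"
    and step_le: "\<gamma> * (\<alpha> * \<Lambda>) \<le> 1"
    and iterates: "delayed_quantized_gradient_iterates M Q \<xi> grad delay \<gamma> x0 x"
begin

lemma \<alpha>_pos: "0 < \<alpha>"
  using quantizer by (simp add: unbiased_random_quantizer_def)

lemma prob_space_noise: "prob_space N"
  using quantizer by (simp add: unbiased_random_quantizer_def)

lemma grad_measurable[measurable]: "grad i \<in> borel_measurable borel"
  by (intro borel_measurable_continuous_onI continuous_grad)

lemma gradF_measurable[measurable]: "gradF \<in> borel_measurable borel"
  unfolding gradF_def[abs_def] by measurable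

lemma F_measurable[measurable]: "F \<in> borel_measurable borel"
  by (intro borel_measurable_continuous_onI continuous_at_imp_continuous_on ballI
      has_derivative_continuous[OF gradient_gradF[unfolded gderiv_def]])

lemma noise_measurable[measurable]: "\<xi> j \<in> M \<rightarrow>\<^sub>M N"
  using noise_indep by (simp add: indep_vars_def)

lemma quantizer_measurable[measurable (raw)]:
  assumes "s \<in> R \<rightarrow>\<^sub>M N" "v \<in> borel_measurable R"
  shows "(\<lambda>r. Q (s r) (v r)) \<in> borel_measurable R"
proof -
  have "(\<lambda>(s, v). Q s v) \<in> borel_measurable (N \<Otimes>\<^sub>M borel)"
    using quantizer by (simp add: unbiased_random_quantizer_def)
  from measurable_compose[OF measurable_Pair[OF assms] this] show ?thesis
    by simp
qed

definition g :: "nat \<Rightarrow> 'w \<Rightarrow> real ^ 'd" where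
  "g k \<omega> = (\<Sum>i\<in>UNIV. grad i (x (k - delay k i) \<omega>))"

lemma x_0: "\<omega> \<in> space M \<Longrightarrow> x 0 \<omega> = x0"
  and x_Suc: "\<omega> \<in> space M \<Longrightarrow> x (Suc k) \<omega> = x k \<omega> - \<gamma> *\<^sub>R Q (\<xi> k \<omega>) (g k \<omega>)"
  using iterates by (auto simp: delayed_quantized_gradient_iterates_def g_def)

text \<open>
  The filtration: the events decided by the noises that drive the first \<open>k\<close> steps, as a
  sigma-algebra on the underlying probability space.
\<close>

definition past :: "nat \<Rightarrow> 'w measure" where
  "past k = vimage_algebra (space M) (\<lambda>\<omega>. \<lambda>j\<in>{..<k}. \<xi> j \<omega>) (PiM {..<k} (\<lambda>_. N))"

lemma space_past[simp]: "space (past k) = space M"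
  by (simp add: past_def)

lemma noise_measurable_past:
  assumes "j < k"
  shows "\<xi> j \<in> past k \<rightarrow>\<^sub>M N"
proof -
  have "(\<lambda>\<omega>. \<lambda>j\<in>{..<k}. \<xi> j \<omega>) \<in> past k \<rightarrow>\<^sub>M PiM {..<k} (\<lambda>_. N)"
    unfolding past_def using measurable_space[OF noise_measurable]
    by (intro measurable_vimage_algebra1) (auto simp: space_PiM)
  from measurable_compose[OF this measurable_component_singleton[of j]] assms show ?thesis
    by simp
qed

lemma past_subalgebra: "(\<lambda>\<omega>. \<omega>) \<in> M \<rightarrow>\<^sub>M past k"
  unfolding past_def by (intro measurable_vimage_algebra2) auto

text \<open>
  An event of the past is a preimage under the tuple of earlier
  noises, and this tuple is independent of the one-element tuple formed by \<open>\<xi> k\<close>; the latter detour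
  makes both sides functions of the same type, as the notion of independent variables requires.
\<close>

lemma past_noise_joint:
  "distr M (past k \<Otimes>\<^sub>M N) (\<lambda>\<omega>. (\<omega>, \<xi> k \<omega>)) = distr M (past k) (\<lambda>\<omega>. \<omega>) \<Otimes>\<^sub>M N"
proof (rule sym, rule pair_measure_eqI)
  have [measurable]: "(\<lambda>\<omega>. \<omega>) \<in> M \<rightarrow>\<^sub>M past k"
    by (rule past_subalgebra)
  interpret P: prob_space "distr M (past k) (\<lambda>\<omega>. \<omega>)"
    by (rule prob_space_distr) simp
  interpret N: prob_space N
    by (rule prob_space_noise)
  show "sigma_finite_measure (distr M (past k) (\<lambda>\<omega>. \<omega>))" "sigma_finite_measure N"
    by unfold_locales
  fix A B assume A[measurable]: "A \<in> sets (distr M (past k) (\<lambda>\<omega>. \<omega>))" and B[measurable]: "B \<in> sets N"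
  define hist where "hist = (\<lambda>\<omega>. \<lambda>j\<in>{..<k}. \<xi> j \<omega>)"
  have "hist \<in> space M \<rightarrow> space (PiM {..<k} (\<lambda>_. N))"
    using measurable_space[OF noise_measurable] by (auto simp: hist_def space_PiM)
  then obtain A' where A': "A' \<in> sets (PiM {..<k} (\<lambda>_. N))" "A = hist -` A' \<inter> space M"
    using A by (auto simp: past_def hist_def[symmetric] sets_vimage_algebra2)
  define B' where "B' = (\<lambda>f. f k) -` B \<inter> space (PiM {k} (\<lambda>_. N))"
  have B': "B' \<in> sets (PiM {k} (\<lambda>_. N))"
    unfolding B'_def by measurable
  have noise_B': "(\<lambda>j\<in>{k}. \<xi> j \<omega>) \<in> B' \<longleftrightarrow> \<xi> k \<omega> \<in> B" if "\<omega> \<in> space M" for \<omega>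
    using that measurable_space[OF noise_measurable, of \<omega> k] by (auto simp: B'_def space_PiM)
  have indep: "indep_var (PiM {..<k} (\<lambda>_. N)) hist (PiM {k} (\<lambda>_. N)) (\<lambda>\<omega>. \<lambda>j\<in>{k}. \<xi> j \<omega>)"
    unfolding hist_def by (rule indep_var_restrict[OF noise_indep]) auto
  have "emeasure (distr M (past k \<Otimes>\<^sub>M N) (\<lambda>\<omega>. (\<omega>, \<xi> k \<omega>))) (A \<times> B)
      = emeasure M ((\<lambda>\<omega>. (hist \<omega>, \<lambda>j\<in>{k}. \<xi> j \<omega>)) -` (A' \<times> B') \<inter> space M)"
    using A B A'(2) noise_B' by (subst emeasure_distr) (auto intro!: arg_cong[where f = "emeasure M"])
  also have "\<dots> = ennreal (prob (hist -` A' \<inter> space M) * prob ((\<lambda>\<omega>. \<lambda>j\<in>{k}. \<xi> j \<omega>) -` B' \<inter> space M))"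
    using indep_varD[OF indep A'(1) B'] by (simp add: emeasure_eq_measure)
  also have "(\<lambda>\<omega>. \<lambda>j\<in>{k}. \<xi> j \<omega>) -` B' \<inter> space M = \<xi> k -` B \<inter> space M"
    using noise_B' by auto
  also have "ennreal (prob (hist -` A' \<inter> space M) * prob (\<xi> k -` B \<inter> space M))
      = emeasure (distr M (past k) (\<lambda>\<omega>. \<omega>)) A * emeasure (distr M N (\<xi> k)) B"
    using A A'(2) by (simp add: emeasure_distr emeasure_eq_measure ennreal_mult'' vimage_def Int_def conj_commute)
  finally show "emeasure (distr M (past k) (\<lambda>\<omega>. \<omega>)) A * emeasure N B
      = emeasure (distr M (past k \<Otimes>\<^sub>M N) (\<lambda>\<omega>. (\<omega>, \<xi> k \<omega>))) (A \<times> B)"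
    by (simp add: noise_distr)
qed simp

lemma measurable_past_imp:
  assumes "u \<in> past k \<rightarrow>\<^sub>M R"
  shows "u \<in> M \<rightarrow>\<^sub>M R"
  using measurable_compose[OF past_subalgebra assms] .

lemma x_measurable_past: "j \<le> k \<Longrightarrow> x j \<in> borel_measurable (past k)"
proof (induction j rule: less_induct)
  case (less j)
  show ?case
  proof (cases j)
    case 0
    then show ?thesis
      using x_0 measurable_cong[of "past k" "x 0" "\<lambda>_. x0" borel] by simp
  next
    case (Suc l)
    then have [measurable]: "\<xi> l \<in> past k \<rightarrow>\<^sub>M N" "x l \<in> borel_measurable (past k)"
      "x (l - delay l i) \<in> borel_measurable (past k)" for i
      using less noise_measurable_past[of l k] by auto
    have "(\<lambda>\<omega>. x l \<omega> - \<gamma> *\<^sub>R Q (\<xi> l \<omega>) (g l \<omega>)) \<in> borel_measurable (past k)"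
      unfolding g_def by measurable
    then show ?thesis
      using x_Suc[of _ l] Suc measurable_cong[of "past k" "x (Suc l)" "\<lambda>\<omega>. x l \<omega> - \<gamma> *\<^sub>R Q (\<xi> l \<omega>) (g l \<omega>)" borel]
      by simp
  qed
qed

lemma g_measurable_past: "g k \<in> borel_measurable (past k)"
proof -
  have [measurable]: "x (k - delay k i) \<in> borel_measurable (past k)" for i
    by (rule x_measurable_past) simp
  show ?thesis
    unfolding g_def by measurable
qed

lemma x_measurable[measurable]: "x k \<in> borel_measurable M"
  by (rule measurable_past_imp[OF x_measurable_past[OF order_refl]])

lemma g_measurable[measurable]: "g k \<in> borel_measurable M"
  by (rule measurable_past_imp[OF g_measurable_past])

text \<open>
  By Fubini, the quantizer's second moment bound may be applied for each fixed value of \<open>v\<close>. Nonnegative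
  integrals come first, since integrability is part of the claim.
\<close>

lemma
  assumes v[measurable]: "v \<in> borel_measurable (past k)"
    and int: "integrable M (\<lambda>\<omega>. (norm (v \<omega>))\<^sup>2)"
  shows quantized_square_integrable: "integrable M (\<lambda>\<omega>. (norm (Q (\<xi> k \<omega>) (v \<omega>)))\<^sup>2)"
    and quantized_second_moment:
      "expectation (\<lambda>\<omega>. (norm (Q (\<xi> k \<omega>) (v \<omega>)))\<^sup>2) \<le> \<alpha> * expectation (\<lambda>\<omega>. (norm (v \<omega>))\<^sup>2)"
proof -
  have vM[measurable]: "v \<in> borel_measurable M"
    by (rule measurable_past_imp[OF v])
  have pointwise: "(\<integral>\<^sup>+s. ennreal ((norm (Q s y))\<^sup>2) \<partial>N) \<le> ennreal (\<alpha> * (norm y)\<^sup>2)" for y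
    using quantizer unfolding unbiased_random_quantizer_def
    by (subst nn_integral_eq_integral) (auto intro: ennreal_leI)
  have "(\<integral>\<^sup>+\<omega>. ennreal ((norm (Q (\<xi> k \<omega>) (v \<omega>)))\<^sup>2) \<partial>M)
      = (\<integral>\<^sup>+\<omega>. \<integral>\<^sup>+s. ennreal ((norm (Q s (v \<omega>)))\<^sup>2) \<partial>N \<partial>M)"
    by (rule nn_integral_product_joint[OF past_subalgebra noise_measurable past_noise_joint prob_space_noise]) measurable
  also have "\<dots> \<le> (\<integral>\<^sup>+\<omega>. ennreal (\<alpha> * (norm (v \<omega>))\<^sup>2) \<partial>M)"
    by (intro nn_integral_mono pointwise)
  also have "\<dots> = ennreal (\<alpha> * expectation (\<lambda>\<omega>. (norm (v \<omega>))\<^sup>2))"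
    using int \<alpha>_pos by (subst nn_integral_eq_integral) auto
  finally have bound: "(\<integral>\<^sup>+\<omega>. ennreal ((norm (Q (\<xi> k \<omega>) (v \<omega>)))\<^sup>2) \<partial>M)
      \<le> ennreal (\<alpha> * expectation (\<lambda>\<omega>. (norm (v \<omega>))\<^sup>2))" .
  show Q_int: "integrable M (\<lambda>\<omega>. (norm (Q (\<xi> k \<omega>) (v \<omega>)))\<^sup>2)"
    using le_less_trans[OF bound ennreal_less_top]
    by (intro integrableI_nonneg) auto
  show "expectation (\<lambda>\<omega>. (norm (Q (\<xi> k \<omega>) (v \<omega>)))\<^sup>2) \<le> \<alpha> * expectation (\<lambda>\<omega>. (norm (v \<omega>))\<^sup>2)"
    using bound \<alpha>_pos by (simp add: nn_integral_eq_integral[OF Q_int] ennreal_le_iff)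
qed

lemma
  assumes u[measurable]: "u \<in> borel_measurable (past k)" and v[measurable]: "v \<in> borel_measurable (past k)"
    and int: "integrable M (\<lambda>\<omega>. (norm (u \<omega>))\<^sup>2)" "integrable M (\<lambda>\<omega>. (norm (v \<omega>))\<^sup>2)"
  shows integrable_inner_quantized: "integrable M (\<lambda>\<omega>. u \<omega> \<bullet> Q (\<xi> k \<omega>) (v \<omega>))"
    and expectation_inner_quantized:
      "expectation (\<lambda>\<omega>. u \<omega> \<bullet> Q (\<xi> k \<omega>) (v \<omega>)) = expectation (\<lambda>\<omega>. u \<omega> \<bullet> v \<omega>)"
proof -
  have [measurable]: "u \<in> borel_measurable M" "v \<in> borel_measurable M"
    by (rule measurable_past_imp[OF u], rule measurable_past_imp[OF v])
  have abs_inner: "norm (y \<bullet> z) \<le> norm ((norm y)\<^sup>2 + (norm z)\<^sup>2)" for y z :: "real ^ 'd"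
  proof -
    have "norm (y \<bullet> z) \<le> norm y * norm z"
      by (simp add: Cauchy_Schwarz_ineq2)
    also have "\<dots> \<le> 2 * norm y * norm z"
      by simp
    also have "\<dots> \<le> (norm y)\<^sup>2 + (norm z)\<^sup>2"
      by (rule sum_squares_bound)
    finally show ?thesis
      by simp
  qed
  have unbiased: "(\<integral>s. y \<bullet> Q s z \<partial>N) = y \<bullet> z" for y z
    using quantizer integral_inner_right[of y N "\<lambda>s. Q s z"]
    unfolding unbiased_random_quantizer_def by metis
  show Q_int: "integrable M (\<lambda>\<omega>. u \<omega> \<bullet> Q (\<xi> k \<omega>) (v \<omega>))"
    by (rule Bochner_Integration.integrable_bound[OF Bochner_Integration.integrable_add[OF int(1) quantized_square_integrable[OF v int(2)]]])
      (measurable, intro AE_I2 abs_inner)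
  have "expectation (\<lambda>\<omega>. u \<omega> \<bullet> Q (\<xi> k \<omega>) (v \<omega>)) = expectation (\<lambda>\<omega>. \<integral>s. u \<omega> \<bullet> Q s (v \<omega>) \<partial>N)"
    by (rule expectation_product_joint[OF past_subalgebra noise_measurable past_noise_joint prob_space_noise,
          where h = "\<lambda>\<omega> s. u \<omega> \<bullet> Q s (v \<omega>)", OF _ Q_int]) measurable
  also have "\<dots> = expectation (\<lambda>\<omega>. u \<omega> \<bullet> v \<omega>)"
    by (simp only: unbiased)
  finally show "expectation (\<lambda>\<omega>. u \<omega> \<bullet> Q (\<xi> k \<omega>) (v \<omega>)) = expectation (\<lambda>\<omega>. u \<omega> \<bullet> v \<omega>)" .
qed


lemma norm_g_sq_le: "(norm (g k \<omega>))\<^sup>2 \<le> (\<Sum>i\<in>UNIV. w i * (norm (x (k - delay k i) \<omega> - xstar))\<^sup>2)"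
  using weighted_lipschitz[of "\<lambda>i. x (k - delay k i) \<omega>" "\<lambda>_. xstar"] gradF_xstar
  by (simp add: g_def gradF_def)

lemma integrable_g_sq_if:
  assumes "\<And>j. j \<le> k \<Longrightarrow> integrable M (\<lambda>\<omega>. (norm (x j \<omega> - xstar))\<^sup>2)"
  shows "integrable M (\<lambda>\<omega>. (norm (g k \<omega>))\<^sup>2)"
proof (rule Bochner_Integration.integrable_bound)
  show "integrable M (\<lambda>\<omega>. \<Sum>i\<in>UNIV. w i * (norm (x (k - delay k i) \<omega> - xstar))\<^sup>2)"
    by (intro Bochner_Integration.integrable_sum integrable_mult_right assms) simp
  show "AE \<omega> in M. norm ((norm (g k \<omega>))\<^sup>2) \<le> norm (\<Sum>i\<in>UNIV. w i * (norm (x (k - delay k i) \<omega> - xstar))\<^sup>2)"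
  proof (intro AE_I2)
    fix \<omega>
    show "norm ((norm (g k \<omega>))\<^sup>2) \<le> norm (\<Sum>i\<in>UNIV. w i * (norm (x (k - delay k i) \<omega> - xstar))\<^sup>2)"
      using norm_g_sq_le[of k \<omega>] by simp
  qed
qed measurable

text \<open>
  Square integrability propagates along the iteration: the delayed gradient is dominated by distances
  of earlier iterates to the minimizer, and quantization keeps second moments finite.
\<close>

lemma integrable_x_sq: "integrable M (\<lambda>\<omega>. (norm (x k \<omega> - xstar))\<^sup>2)"
proof (induction k rule: less_induct)
  case (less k)
  show ?case
  proof (cases k)
    case 0
    have "integrable M (\<lambda>\<omega>. (norm (x k \<omega> - xstar))\<^sup>2) \<longleftrightarrow> integrable M (\<lambda>_. (norm (x0 - xstar))\<^sup>2)"
      by (rule Bochner_Integration.integrable_cong) (simp_all add: 0 x_0)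
    then show ?thesis
      by simp
  next
    case (Suc l)
    have "integrable M (\<lambda>\<omega>. (norm (g l \<omega>))\<^sup>2)"
      using less Suc by (intro integrable_g_sq_if) auto
    then have Q_int: "integrable M (\<lambda>\<omega>. (norm (Q (\<xi> l \<omega>) (g l \<omega>)))\<^sup>2)"
      by (intro quantized_square_integrable g_measurable_past)
    show ?thesis
    proof (rule Bochner_Integration.integrable_bound)
      show "integrable M (\<lambda>\<omega>. 2 * (norm (x l \<omega> - xstar))\<^sup>2 + 2 * (\<gamma>\<^sup>2 * (norm (Q (\<xi> l \<omega>) (g l \<omega>)))\<^sup>2))"
        using less Suc Q_int by (intro Bochner_Integration.integrable_add integrable_mult_right) auto
      have sq_diff: "(norm (u - \<gamma> *\<^sub>R v))\<^sup>2 \<le> 2 * (norm u)\<^sup>2 + 2 * (\<gamma>\<^sup>2 * (norm v)\<^sup>2)" for u v :: "real ^ 'd"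
      proof -
        have "(norm (u - \<gamma> *\<^sub>R v))\<^sup>2 \<le> (norm u + norm (\<gamma> *\<^sub>R v))\<^sup>2"
          by (intro power_mono norm_triangle_ineq4) simp
        also have "\<dots> \<le> 2 * (norm u)\<^sup>2 + 2 * (norm (\<gamma> *\<^sub>R v))\<^sup>2"
          using sum_squares_bound[of "norm u" "norm (\<gamma> *\<^sub>R v)"] by (simp add: power2_sum)
        finally show ?thesis
          by (simp add: power_mult_distrib)
      qed
      show "AE \<omega> in M. norm ((norm (x k \<omega> - xstar))\<^sup>2)
          \<le> norm (2 * (norm (x l \<omega> - xstar))\<^sup>2 + 2 * (\<gamma>\<^sup>2 * (norm (Q (\<xi> l \<omega>) (g l \<omega>)))\<^sup>2))"
      proof (intro AE_I2)
        fix \<omega> assume "\<omega> \<in> space M"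
        then have "x k \<omega> - xstar = (x l \<omega> - xstar) - \<gamma> *\<^sub>R Q (\<xi> l \<omega>) (g l \<omega>)"
          by (simp add: Suc x_Suc)
        then have "(norm (x k \<omega> - xstar))\<^sup>2
            \<le> 2 * (norm (x l \<omega> - xstar))\<^sup>2 + 2 * (\<gamma>\<^sup>2 * (norm (Q (\<xi> l \<omega>) (g l \<omega>)))\<^sup>2)"
          by (simp only: sq_diff)
        then show "norm ((norm (x k \<omega> - xstar))\<^sup>2)
            \<le> norm (2 * (norm (x l \<omega> - xstar))\<^sup>2 + 2 * (\<gamma>\<^sup>2 * (norm (Q (\<xi> l \<omega>) (g l \<omega>)))\<^sup>2))"
          by simp
      qed
    qed measurable
  qed
qed

lemma integrable_g_sq: "integrable M (\<lambda>\<omega>. (norm (g k \<omega>))\<^sup>2)"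
  by (intro integrable_g_sq_if integrable_x_sq)

lemma integrable_gap: "integrable M (\<lambda>\<omega>. F (x k \<omega>) - F xstar)"
proof (rule Bochner_Integration.integrable_bound)
  show "integrable M (\<lambda>\<omega>. \<Lambda> / 2 * (norm (x k \<omega> - xstar))\<^sup>2)"
    by (intro integrable_mult_right integrable_x_sq)
  show "AE \<omega> in M. norm (F (x k \<omega>) - F xstar) \<le> norm (\<Lambda> / 2 * (norm (x k \<omega> - xstar))\<^sup>2)"
    using gap_le minimal \<Lambda>_pos by (intro AE_I2) (simp add: abs_mult)
qed measurable

section \<open>Expected gap and staleness\<close>

definition gap :: "nat \<Rightarrow> real" where
  "gap k = expectation (\<lambda>\<omega>. F (x k \<omega>) - F xstar)"

lemma gap_nonneg: "0 \<le> gap k"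
  unfolding gap_def by (rule integral_nonneg_AE) (simp add: minimal)

lemma gap_0: "gap 0 = F x0 - F xstar"
proof -
  have "gap 0 = expectation (\<lambda>_. F x0 - F xstar)"
    unfolding gap_def by (rule Bochner_Integration.integral_cong) (simp_all add: x_0)
  then show ?thesis
    by (simp add: prob_space)
qed

lemma expectation_dist_le_gap: "expectation (\<lambda>\<omega>. (norm (x k \<omega> - xstar))\<^sup>2) \<le> 2 / \<mu> * gap k"
proof -
  have "(norm (y - xstar))\<^sup>2 \<le> 2 / \<mu> * (F y - F xstar)" for y
    using quadratic_growth[of y] \<mu>_pos by (simp add: field_simps)
  then have "expectation (\<lambda>\<omega>. (norm (x k \<omega> - xstar))\<^sup>2) \<le> expectation (\<lambda>\<omega>. 2 / \<mu> * (F (x k \<omega>) - F xstar))"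
    by (intro integral_mono integrable_x_sq integrable_mult_right integrable_gap)
  then show ?thesis
    by (simp only: integral_mult_right_zero gap_def)
qed

text \<open>
  Here the weights pay off: the bound \<open>R\<close> is needed for each expectation separately, not for the
  expectation of the largest \<open>r i\<close>.
\<close>

lemma expectation_weighted_sum:
  assumes "\<And>i. integrable M (r i)" and "\<And>i. expectation (r i) \<le> R"
  shows "expectation (\<lambda>\<omega>. \<Sum>i\<in>UNIV. w i * r i \<omega>) \<le> \<Lambda>\<^sup>2 * R"
proof -
  have "expectation (\<lambda>\<omega>. \<Sum>i\<in>UNIV. w i * r i \<omega>) = (\<Sum>i\<in>UNIV. w i * expectation (r i))"
    using assms(1) by (subst Bochner_Integration.integral_sum) auto
  also have "\<dots> \<le> (\<Sum>i\<in>UNIV. w i * R)"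
    by (intro sum_mono mult_left_mono assms w_nonneg)
  finally show ?thesis
    by (simp only: sum_distrib_right[symmetric] sum_w)
qed

text \<open>
  The component gradients cancel in total at the minimizer, so \<open>g k\<close> is a sum of gradient differences
  between delayed iterates and \<open>xstar\<close>, and quadratic growth converts distances into gaps.
\<close>

lemma expectation_g_sq_le:
  assumes "\<And>j. k - \<tau> \<le> j \<Longrightarrow> j \<le> k \<Longrightarrow> gap j \<le> W"
  shows "expectation (\<lambda>\<omega>. (norm (g k \<omega>))\<^sup>2) \<le> \<Lambda>\<^sup>2 * (2 / \<mu> * W)"
proof -
  have "expectation (\<lambda>\<omega>. (norm (g k \<omega>))\<^sup>2)
      \<le> expectation (\<lambda>\<omega>. \<Sum>i\<in>UNIV. w i * (norm (x (k - delay k i) \<omega> - xstar))\<^sup>2)"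
    by (intro integral_mono integrable_g_sq norm_g_sq_le Bochner_Integration.integrable_sum
        integrable_mult_right integrable_x_sq)
  also have "\<dots> \<le> \<Lambda>\<^sup>2 * (2 / \<mu> * W)"
  proof (rule expectation_weighted_sum[OF integrable_x_sq])
    fix i
    have "2 / \<mu> * gap (k - delay k i) \<le> 2 / \<mu> * W"
      using \<mu>_pos delays[of k i] by (intro mult_left_mono assms) auto
    then show "expectation (\<lambda>\<omega>. (norm (x (k - delay k i) \<omega> - xstar))\<^sup>2) \<le> 2 / \<mu> * W"
      using expectation_dist_le_gap[of "k - delay k i"] by linarith
  qed
  finally show ?thesis .
qed

lemma
  shows integrable_increment_sq: "integrable M (\<lambda>\<omega>. (norm (x (Suc k) \<omega> - x k \<omega>))\<^sup>2)"
    and expectation_increment_sq_le: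
      "expectation (\<lambda>\<omega>. (norm (x (Suc k) \<omega> - x k \<omega>))\<^sup>2) \<le> \<gamma>\<^sup>2 * (\<alpha> * expectation (\<lambda>\<omega>. (norm (g k \<omega>))\<^sup>2))"
proof -
  have eq: "(norm (x (Suc k) \<omega> - x k \<omega>))\<^sup>2 = \<gamma>\<^sup>2 * (norm (Q (\<xi> k \<omega>) (g k \<omega>)))\<^sup>2" if "\<omega> \<in> space M" for \<omega>
    using that by (simp add: x_Suc power_mult_distrib)
  have Q_int: "integrable M (\<lambda>\<omega>. \<gamma>\<^sup>2 * (norm (Q (\<xi> k \<omega>) (g k \<omega>)))\<^sup>2)"
    by (intro integrable_mult_right quantized_square_integrable g_measurable_past integrable_g_sq)
  show "integrable M (\<lambda>\<omega>. (norm (x (Suc k) \<omega> - x k \<omega>))\<^sup>2)"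
    using Q_int by (subst Bochner_Integration.integrable_cong[OF refl eq])
  have "expectation (\<lambda>\<omega>. (norm (x (Suc k) \<omega> - x k \<omega>))\<^sup>2)
      = \<gamma>\<^sup>2 * expectation (\<lambda>\<omega>. (norm (Q (\<xi> k \<omega>) (g k \<omega>)))\<^sup>2)"
    by (subst Bochner_Integration.integral_cong[OF refl eq]) simp_all
  also have "\<dots> \<le> \<gamma>\<^sup>2 * (\<alpha> * expectation (\<lambda>\<omega>. (norm (g k \<omega>))\<^sup>2))"
    by (intro mult_left_mono quantized_second_moment g_measurable_past integrable_g_sq) simp
  finally show "expectation (\<lambda>\<omega>. (norm (x (Suc k) \<omega> - x k \<omega>))\<^sup>2)
      \<le> \<gamma>\<^sup>2 * (\<alpha> * expectation (\<lambda>\<omega>. (norm (g k \<omega>))\<^sup>2))" .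
qed

text \<open>
  At most \<open>\<tau>\<close> increments lie between the two iterates; one factor \<open>\<tau>\<close> comes from Cauchy-Schwarz and the
  other one from their number.
\<close>

lemma
  assumes "j \<le> k" "k - j \<le> \<tau>"
  shows integrable_drift_sq: "integrable M (\<lambda>\<omega>. (norm (x k \<omega> - x j \<omega>))\<^sup>2)"
    and expectation_drift_sq_le: "(\<And>l. j \<le> l \<Longrightarrow> l < k \<Longrightarrow> expectation (\<lambda>\<omega>. (norm (g l \<omega>))\<^sup>2) \<le> B) \<Longrightarrow> 0 \<le> B \<Longrightarrow>
      expectation (\<lambda>\<omega>. (norm (x k \<omega> - x j \<omega>))\<^sup>2) \<le> (real \<tau>)\<^sup>2 * (\<gamma>\<^sup>2 * (\<alpha> * B))"
proof -
  have bound: "(norm (x k \<omega> - x j \<omega>))\<^sup>2 \<le> real \<tau> * (\<Sum>l\<in>{j..<k}. (norm (x (Suc l) \<omega> - x l \<omega>))\<^sup>2)" for \<omega>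
  proof -
    have "real (k - j) * (\<Sum>l\<in>{j..<k}. (norm (x (Suc l) \<omega> - x l \<omega>))\<^sup>2)
        \<le> real \<tau> * (\<Sum>l\<in>{j..<k}. (norm (x (Suc l) \<omega> - x l \<omega>))\<^sup>2)"
      using assms by (intro mult_right_mono sum_nonneg) auto
    then show ?thesis
      using norm_diff_sq_le_sum_increments[OF assms(1), of "\<lambda>l. x l \<omega>"] by linarith
  qed
  have sum_int: "integrable M (\<lambda>\<omega>. real \<tau> * (\<Sum>l\<in>{j..<k}. (norm (x (Suc l) \<omega> - x l \<omega>))\<^sup>2))"
    by (intro integrable_mult_right Bochner_Integration.integrable_sum integrable_increment_sq)
  show int: "integrable M (\<lambda>\<omega>. (norm (x k \<omega> - x j \<omega>))\<^sup>2)"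
    by (rule Bochner_Integration.integrable_bound[OF sum_int])
      (measurable, intro AE_I2, simp only: real_norm_def abs_power2 order_trans[OF bound abs_ge_self])
  assume B: "\<And>l. j \<le> l \<Longrightarrow> l < k \<Longrightarrow> expectation (\<lambda>\<omega>. (norm (g l \<omega>))\<^sup>2) \<le> B" "0 \<le> B"
  have "expectation (\<lambda>\<omega>. (norm (x k \<omega> - x j \<omega>))\<^sup>2)
      \<le> expectation (\<lambda>\<omega>. real \<tau> * (\<Sum>l\<in>{j..<k}. (norm (x (Suc l) \<omega> - x l \<omega>))\<^sup>2))"
    by (intro integral_mono int sum_int bound)
  also have "\<dots> = real \<tau> * (\<Sum>l\<in>{j..<k}. expectation (\<lambda>\<omega>. (norm (x (Suc l) \<omega> - x l \<omega>))\<^sup>2))"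
    by (simp add: integrable_increment_sq)
  also have "\<dots> \<le> real \<tau> * (\<Sum>l\<in>{j..<k}. \<gamma>\<^sup>2 * (\<alpha> * B))"
  proof (intro mult_left_mono sum_mono)
    fix l assume l: "l \<in> {j..<k}"
    have "\<gamma>\<^sup>2 * (\<alpha> * expectation (\<lambda>\<omega>. (norm (g l \<omega>))\<^sup>2)) \<le> \<gamma>\<^sup>2 * (\<alpha> * B)"
      using l \<alpha>_pos by (intro mult_left_mono B) auto
    then show "expectation (\<lambda>\<omega>. (norm (x (Suc l) \<omega> - x l \<omega>))\<^sup>2) \<le> \<gamma>\<^sup>2 * (\<alpha> * B)"
      using expectation_increment_sq_le[of l] by linarith
  qed simp
  also have "\<dots> = real \<tau> * real (k - j) * (\<gamma>\<^sup>2 * (\<alpha> * B))"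
    by simp
  also have "\<dots> \<le> real \<tau> * real \<tau> * (\<gamma>\<^sup>2 * (\<alpha> * B))"
    using assms \<alpha>_pos B(2) by (intro mult_right_mono mult_left_mono) auto
  finally show "expectation (\<lambda>\<omega>. (norm (x k \<omega> - x j \<omega>))\<^sup>2) \<le> (real \<tau>)\<^sup>2 * (\<gamma>\<^sup>2 * (\<alpha> * B))"
    by (simp add: power2_eq_square)
qed

text \<open>
  Two delays add up: the stale gradient refers to iterates up to \<open>\<tau>\<close> steps back, and the increments
  since then used gradients that were themselves up to \<open>\<tau>\<close> steps old. Hence the window of length \<open>2 \<tau>\<close>.
\<close>

lemma
  shows integrable_staleness_sq: "integrable M (\<lambda>\<omega>. (norm (gradF (x k \<omega>) - g k \<omega>))\<^sup>2)"
    and expectation_staleness_sq_le: "(\<And>j. k - 2 * \<tau> \<le> j \<Longrightarrow> j \<le> k \<Longrightarrow> gap j \<le> W) \<Longrightarrow>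
      expectation (\<lambda>\<omega>. (norm (gradF (x k \<omega>) - g k \<omega>))\<^sup>2)
        \<le> \<Lambda>\<^sup>2 * ((real \<tau>)\<^sup>2 * (\<gamma>\<^sup>2 * (\<alpha> * (\<Lambda>\<^sup>2 * (2 / \<mu> * W)))))"
proof -
  have bound: "(norm (gradF (x k \<omega>) - g k \<omega>))\<^sup>2
      \<le> (\<Sum>i\<in>UNIV. w i * (norm (x k \<omega> - x (k - delay k i) \<omega>))\<^sup>2)" for \<omega>
    using weighted_lipschitz[of "\<lambda>_. x k \<omega>" "\<lambda>i. x (k - delay k i) \<omega>"] by (simp add: g_def gradF_def)
  have recent: "k - delay k i \<le> k" "k - (k - delay k i) \<le> \<tau>" for i
    using delays[of k i] by auto
  have sum_int: "integrable M (\<lambda>\<omega>. \<Sum>i\<in>UNIV. w i * (norm (x k \<omega> - x (k - delay k i) \<omega>))\<^sup>2)"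
    by (intro integrable_mult_right Bochner_Integration.integrable_sum integrable_drift_sq recent)
  show int: "integrable M (\<lambda>\<omega>. (norm (gradF (x k \<omega>) - g k \<omega>))\<^sup>2)"
    by (rule Bochner_Integration.integrable_bound[OF sum_int])
      (measurable, intro AE_I2, simp only: real_norm_def abs_power2 order_trans[OF bound abs_ge_self])
  assume W: "\<And>j. k - 2 * \<tau> \<le> j \<Longrightarrow> j \<le> k \<Longrightarrow> gap j \<le> W"
  have W_nonneg: "0 \<le> W"
    using W[of k] gap_nonneg[of k] by simp
  have "expectation (\<lambda>\<omega>. (norm (gradF (x k \<omega>) - g k \<omega>))\<^sup>2)
      \<le> expectation (\<lambda>\<omega>. \<Sum>i\<in>UNIV. w i * (norm (x k \<omega> - x (k - delay k i) \<omega>))\<^sup>2)"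
    by (intro integral_mono int sum_int bound)
  also have "\<dots> \<le> \<Lambda>\<^sup>2 * ((real \<tau>)\<^sup>2 * (\<gamma>\<^sup>2 * (\<alpha> * (\<Lambda>\<^sup>2 * (2 / \<mu> * W)))))"
  proof (rule expectation_weighted_sum)
    fix i
    show "integrable M (\<lambda>\<omega>. (norm (x k \<omega> - x (k - delay k i) \<omega>))\<^sup>2)"
      by (intro integrable_drift_sq recent)
    show "expectation (\<lambda>\<omega>. (norm (x k \<omega> - x (k - delay k i) \<omega>))\<^sup>2)
        \<le> (real \<tau>)\<^sup>2 * (\<gamma>\<^sup>2 * (\<alpha> * (\<Lambda>\<^sup>2 * (2 / \<mu> * W))))"
    proof (intro expectation_drift_sq_le recent)
      fix l assume l: "k - delay k i \<le> l" "l < k"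
      show "expectation (\<lambda>\<omega>. (norm (g l \<omega>))\<^sup>2) \<le> \<Lambda>\<^sup>2 * (2 / \<mu> * W)"
        using l delays[of k i] by (intro expectation_g_sq_le W) auto
    qed (use \<mu>_pos W_nonneg in simp)
  qed
  finally show "expectation (\<lambda>\<omega>. (norm (gradF (x k \<omega>) - g k \<omega>))\<^sup>2)
      \<le> \<Lambda>\<^sup>2 * ((real \<tau>)\<^sup>2 * (\<gamma>\<^sup>2 * (\<alpha> * (\<Lambda>\<^sup>2 * (2 / \<mu> * W)))))" .
qed

text \<open>
  Unbiasedness replaces the inner product with the quantized gradient by \<open>grad F (x k) \<bullet> g k\<close>, which the
  polarization identity splits into squares. The step size condition makes \<open>\<gamma>/2 E |g k|\<^sup>2\<close> absorb the
  second order term of the descent inequality.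
\<close>

lemma gap_Suc_le:
  assumes W: "\<And>j. k - 2 * \<tau> \<le> j \<Longrightarrow> j \<le> k \<Longrightarrow> gap j \<le> W"
  shows "gap (Suc k) \<le> (1 - \<mu> * \<gamma>) * gap k + \<Lambda> ^ 4 * \<gamma> ^ 3 * (real \<tau>)\<^sup>2 * \<alpha> / \<mu> * W"
proof -
  define D where "D \<omega> = gradF (x k \<omega>)" for \<omega>
  define u where "u \<omega> = Q (\<xi> k \<omega>) (g k \<omega>)" for \<omega>
  have D_past: "D \<in> borel_measurable (past k)"
    unfolding D_def using measurable_compose[OF x_measurable_past[OF order_refl] gradF_measurable] .
  note [measurable] = measurable_past_imp[OF D_past]
  note g_past = g_measurable_past[of k]
  have D_int: "integrable M (\<lambda>\<omega>. (norm (D \<omega>))\<^sup>2)"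
  proof (rule Bochner_Integration.integrable_bound)
    show "integrable M (\<lambda>\<omega>. \<Lambda>\<^sup>2 * (norm (x k \<omega> - xstar))\<^sup>2)"
      by (intro integrable_mult_right integrable_x_sq)
    show "AE \<omega> in M. norm ((norm (D \<omega>))\<^sup>2) \<le> norm (\<Lambda>\<^sup>2 * (norm (x k \<omega> - xstar))\<^sup>2)"
    proof (intro AE_I2)
      fix \<omega>
      have "(norm (D \<omega>))\<^sup>2 \<le> (\<Lambda> * norm (x k \<omega> - xstar))\<^sup>2"
        using gradF_lipschitz[of "x k \<omega>" xstar] by (intro power_mono) (simp_all add: D_def gradF_xstar)
      then show "norm ((norm (D \<omega>))\<^sup>2) \<le> norm (\<Lambda>\<^sup>2 * (norm (x k \<omega> - xstar))\<^sup>2)"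
        by (simp add: power_mult_distrib)
    qed
  qed measurable
  have stale_int: "integrable M (\<lambda>\<omega>. (norm (D \<omega> - g k \<omega>))\<^sup>2)"
    unfolding D_def by (rule integrable_staleness_sq)
  have u_int: "integrable M (\<lambda>\<omega>. (norm (u \<omega>))\<^sup>2)" and Du_int: "integrable M (\<lambda>\<omega>. D \<omega> \<bullet> u \<omega>)"
    unfolding u_def
    by (intro quantized_square_integrable integrable_inner_quantized g_past D_past D_int integrable_g_sq)+
  have polar: "D \<omega> \<bullet> g k \<omega> = ((norm (D \<omega>))\<^sup>2 + (norm (g k \<omega>))\<^sup>2 - (norm (D \<omega> - g k \<omega>))\<^sup>2) / 2" for \<omega>
    by (simp add: power2_norm_eq_inner inner_diff_left inner_diff_right inner_commute)
  have E_Du: "expectation (\<lambda>\<omega>. D \<omega> \<bullet> u \<omega>) = (expectation (\<lambda>\<omega>. (norm (D \<omega>))\<^sup>2)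
      + expectation (\<lambda>\<omega>. (norm (g k \<omega>))\<^sup>2) - expectation (\<lambda>\<omega>. (norm (D \<omega> - g k \<omega>))\<^sup>2)) / 2"
    unfolding u_def expectation_inner_quantized[OF D_past g_past D_int integrable_g_sq] polar
    using stale_int by (simp add: D_int integrable_g_sq)
  have "gap (Suc k) \<le> expectation (\<lambda>\<omega>. (F (x k \<omega>) - F xstar) - \<gamma> * (D \<omega> \<bullet> u \<omega>) + \<Lambda> / 2 * \<gamma>\<^sup>2 * (norm (u \<omega>))\<^sup>2)"
    unfolding gap_def
  proof (intro integral_mono integrable_gap Bochner_Integration.integrable_add
      Bochner_Integration.integrable_diff integrable_mult_right u_int Du_int)
    fix \<omega> assume "\<omega> \<in> space M"
    then show "F (x (Suc k) \<omega>) - F xstar \<le> (F (x k \<omega>) - F xstar) - \<gamma> * (D \<omega> \<bullet> u \<omega>) + \<Lambda> / 2 * \<gamma>\<^sup>2 * (norm (u \<omega>))\<^sup>2"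
      using descent[of "x k \<omega>" "- \<gamma> *\<^sub>R u \<omega>"] by (simp add: x_Suc u_def D_def power_mult_distrib)
  qed
  also have "\<dots> = gap k - \<gamma> * expectation (\<lambda>\<omega>. D \<omega> \<bullet> u \<omega>) + \<Lambda> / 2 * \<gamma>\<^sup>2 * expectation (\<lambda>\<omega>. (norm (u \<omega>))\<^sup>2)"
    using integrable_gap[of k] u_int Du_int by (simp add: gap_def)
  finally have step: "gap (Suc k) \<le> gap k - \<gamma> * expectation (\<lambda>\<omega>. D \<omega> \<bullet> u \<omega>)
      + \<Lambda> / 2 * \<gamma>\<^sup>2 * expectation (\<lambda>\<omega>. (norm (u \<omega>))\<^sup>2)" .
  have "\<Lambda> / 2 * \<gamma>\<^sup>2 * expectation (\<lambda>\<omega>. (norm (u \<omega>))\<^sup>2)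
      \<le> \<Lambda> / 2 * \<gamma>\<^sup>2 * (\<alpha> * expectation (\<lambda>\<omega>. (norm (g k \<omega>))\<^sup>2))"
    unfolding u_def using \<Lambda>_pos
    by (intro mult_left_mono quantized_second_moment g_past integrable_g_sq) simp
  also have "\<dots> = \<gamma> / 2 * expectation (\<lambda>\<omega>. (norm (g k \<omega>))\<^sup>2) * (\<gamma> * (\<alpha> * \<Lambda>))"
    by (simp add: power2_eq_square)
  also have "\<dots> \<le> \<gamma> / 2 * expectation (\<lambda>\<omega>. (norm (g k \<omega>))\<^sup>2) * 1"
    using \<gamma>_pos step_le by (intro mult_left_mono mult_nonneg_nonneg integral_nonneg_AE) auto
  finally have "gap (Suc k) \<le> gap k - \<gamma> / 2 * expectation (\<lambda>\<omega>. (norm (D \<omega>))\<^sup>2)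
      + \<gamma> / 2 * expectation (\<lambda>\<omega>. (norm (D \<omega> - g k \<omega>))\<^sup>2)"
    using step unfolding E_Du by (simp add: field_simps)
  moreover have "\<gamma> / 2 * (2 * \<mu> * gap k) \<le> \<gamma> / 2 * expectation (\<lambda>\<omega>. (norm (D \<omega>))\<^sup>2)"
  proof (intro mult_left_mono)
    have "2 * \<mu> * gap k = expectation (\<lambda>\<omega>. 2 * \<mu> * (F (x k \<omega>) - F xstar))"
      by (simp add: gap_def)
    also have "\<dots> \<le> expectation (\<lambda>\<omega>. (norm (D \<omega>))\<^sup>2)"
      unfolding D_def
      by (intro integral_mono gradient_dominance integrable_mult_right integrable_gap D_int[unfolded D_def])
    finally show "2 * \<mu> * gap k \<le> expectation (\<lambda>\<omega>. (norm (D \<omega>))\<^sup>2)" .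
  qed (use \<gamma>_pos in simp)
  moreover have "\<gamma> / 2 * expectation (\<lambda>\<omega>. (norm (D \<omega> - g k \<omega>))\<^sup>2)
      \<le> \<gamma> / 2 * (\<Lambda>\<^sup>2 * ((real \<tau>)\<^sup>2 * (\<gamma>\<^sup>2 * (\<alpha> * (\<Lambda>\<^sup>2 * (2 / \<mu> * W))))))"
    unfolding D_def using \<gamma>_pos by (intro mult_left_mono expectation_staleness_sq_le W) auto
  moreover have "\<gamma> / 2 * (\<Lambda>\<^sup>2 * ((real \<tau>)\<^sup>2 * (\<gamma>\<^sup>2 * (\<alpha> * (\<Lambda>\<^sup>2 * (2 / \<mu> * W))))))
      = \<Lambda> ^ 4 * \<gamma> ^ 3 * (real \<tau>)\<^sup>2 * \<alpha> / \<mu> * W"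
    by (simp add: power2_eq_square power3_eq_cube power4_eq_xxxx)
  ultimately have "gap (Suc k) \<le> gap k - \<gamma> / 2 * (2 * \<mu> * gap k)
      + \<Lambda> ^ 4 * \<gamma> ^ 3 * (real \<tau>)\<^sup>2 * \<alpha> / \<mu> * W"
    by linarith
  also have "gap k - \<gamma> / 2 * (2 * \<mu> * gap k) = (1 - \<mu> * \<gamma>) * gap k"
    by (simp add: algebra_simps)
  finally show ?thesis .
qed

end

section \<open>Convergence rate\<close>

text \<open>
  The variance of \<open>Q v\<close> is nonnegative, so the second moment is at least \<open>|v|\<^sup>2\<close>; evaluate at a unit vector.
\<close>

lemma quantizer_parameter_ge_1:
  fixes Q :: "'s \<Rightarrow> real ^ 'd \<Rightarrow> real ^ 'd"
  assumes "unbiased_random_quantizer N Q \<alpha>"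
  shows "1 \<le> \<alpha>"
proof -
  interpret prob_space N
    using assms by (simp add: unbiased_random_quantizer_def)
  obtain v :: "real ^ 'd" where v: "v \<in> Basis"
    using nonempty_Basis by blast
  have int: "integrable N (\<lambda>s. Q s v)" "integrable N (\<lambda>s. (norm (Q s v))\<^sup>2)"
    and mean: "expectation (\<lambda>s. Q s v) = v"
    and second_moment: "expectation (\<lambda>s. (norm (Q s v))\<^sup>2) \<le> \<alpha> * (norm v)\<^sup>2"
    using assms by (auto simp: unbiased_random_quantizer_def)
  have "0 \<le> expectation (\<lambda>s. (norm (Q s v - v))\<^sup>2)"
    by (intro integral_nonneg_AE) simp
  also have "\<dots> = expectation (\<lambda>s. (norm (Q s v))\<^sup>2 - 2 * (v \<bullet> Q s v) + (norm v)\<^sup>2)"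
    by (simp add: power2_norm_eq_inner inner_diff_left inner_diff_right inner_commute algebra_simps)
  also have "\<dots> = expectation (\<lambda>s. (norm (Q s v))\<^sup>2) - 2 * (v \<bullet> v) + (norm v)\<^sup>2"
    using int by (simp add: mean prob_space)
  finally show ?thesis
    using second_moment v by (simp add: power2_norm_eq_inner)
qed


theorem theorem4p5:
  fixes f :: "'m::finite \<Rightarrow> real ^ 'd \<Rightarrow> real"
    and grad :: "'m \<Rightarrow> real ^ 'd \<Rightarrow> real ^ 'd"
    and F :: "real ^ 'd \<Rightarrow> real"
    and loss :: "real \<Rightarrow> real \<Rightarrow> real"
    and a :: "'m \<Rightarrow> real ^ 'd"
    and b :: "'m \<Rightarrow> real"
    and L \<mu> \<alpha> \<gamma> \<Delta> Lbar p q :: real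
    and \<tau> :: nat
    and delay :: "nat \<Rightarrow> 'm \<Rightarrow> nat"
    and M :: "'w measure"
    and N :: "'s measure"
    and Q :: "'s \<Rightarrow> real ^ 'd \<Rightarrow> real ^ 'd"
    and \<xi> :: "nat \<Rightarrow> 'w \<Rightarrow> 's"
    and x :: "nat \<Rightarrow> 'w \<Rightarrow> real ^ 'd"
    and x0 xstar :: "real ^ 'd"
    and k :: nat
  assumes F_def: "F = (\<lambda>y. \<Sum>i\<in>UNIV. f i y)"
    and gradient: "\<And>i y. GDERIV (f i) y :> grad i y"
    and convex: "\<And>i. convex_on UNIV (f i)"
    and lipschitz: "\<And>i. L-lipschitz_on UNIV (grad i)"
    and lower: "\<And>i y z. f i y + grad i y \<bullet> (z - y) \<le> f i z"
    and upper: "\<And>i y z. f i z \<le> f i y + grad i y \<bullet> (z - y) + L / 2 * (norm (z - y))\<^sup>2"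
    and strong: "strongly_convex_on UNIV \<mu> F" "0 < \<mu>"
    and linear_pred: "\<And>i y. f i y = loss (a i \<bullet> y) (b i)"
    and sparse: "\<And>i y. supp (grad i y) = supp (a i)"
    and minimizer: "is_arg_min F (\<lambda>_. True) xstar"
    and \<Delta>_def: "\<Delta> = min (conflict_ave a) (real (conflict_max a))"
    and Lbar_def: "Lbar = L * sqrt (real CARD('m) * (1 + \<Delta>))"
    and quantizer: "unbiased_random_quantizer N Q \<alpha>"
    and M: "prob_space M"
    and noise_indep: "prob_space.indep_vars M (\<lambda>_. N) \<xi> UNIV"
    and noise_distr: "\<And>j. distr M N (\<xi> j) = N"
    and delays: "\<And>j i. delay j i \<le> \<tau>"
    and step: "0 < \<gamma>" "\<gamma> < max_step \<mu> \<alpha> Lbar \<tau>"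
    and iterates: "delayed_quantized_gradient_iterates M Q \<xi> grad delay \<gamma> x0 x"
    and p_def: "p = 1 - \<mu> * \<gamma>"
    and q_def: "q = Lbar ^ 4 * \<gamma> ^ 3 * (real \<tau>)\<^sup>2 * \<alpha> / \<mu>"
  shows "integrable M (\<lambda>\<omega>. F (x k \<omega>) - F xstar) \<and>
         (\<integral>\<omega>. (F (x k \<omega>) - F xstar) \<partial>M)
           \<le> (p + q) powr (real k / (1 + 2 * real \<tau>)) * (F x0 - F xstar)"
proof -
  define w where "w i = L\<^sup>2 * (1 + real (conflict_degree a i))" for i
  have L_nonneg: "0 \<le> L"
    using lipschitz by (rule lipschitz_on_nonneg)
  have \<Delta>: "\<Delta> = conflict_ave a"
    using conflict_ave_le_max[of a] by (simp add: \<Delta>_def)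
  have \<Delta>_nonneg: "0 \<le> \<Delta>"
    unfolding \<Delta> conflict_ave_def by (intro divide_nonneg_nonneg sum_nonneg) auto
  have \<alpha>: "1 \<le> \<alpha>"
    using quantizer by (rule quantizer_parameter_ge_1)
  have step_small: "\<gamma> < 1 / (\<alpha> * Lbar)"
    using step(2) by (auto simp: max_step_def split: if_splits)
  have "0 \<le> Lbar"
    unfolding Lbar_def using L_nonneg \<Delta>_nonneg by simp
  \<comment> \<open>For \<open>Lbar = 0\<close> the bound \<open>1 / (\<alpha> * Lbar)\<close> is 0 by the convention for division.\<close>
  moreover have "Lbar \<noteq> 0"
    using step(1) step_small by auto
  ultimately have Lbar_pos: "0 < Lbar"
    by simp
  have sum_w: "(\<Sum>i\<in>UNIV. w i) = Lbar\<^sup>2"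
  proof -
    have "(\<Sum>i\<in>UNIV. w i) = L\<^sup>2 * (real CARD('m) * (1 + \<Delta>))"
      unfolding w_def sum_distrib_left[symmetric] sum_conflict_degree \<Delta> ..
    then show ?thesis
      using \<Delta>_nonneg by (simp add: Lbar_def power_mult_distrib)
  qed
  have weighted: "(norm ((\<Sum>i\<in>UNIV. grad i (u i)) - (\<Sum>i\<in>UNIV. grad i (v i))))\<^sup>2
      \<le> (\<Sum>i\<in>UNIV. w i * (norm (u i - v i))\<^sup>2)" for u v
  proof -
    have "(norm (\<Sum>i\<in>UNIV. grad i (u i) - grad i (v i)))\<^sup>2
        \<le> (\<Sum>i\<in>UNIV. (1 + real (conflict_degree a i)) * (norm (grad i (u i) - grad i (v i)))\<^sup>2)"
    proof (rule norm_sum_sq_le_conflict)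
      fix i
      have "supp (grad i (u i) - grad i (v i)) \<subseteq> supp (grad i (u i)) \<union> supp (grad i (v i))"
        by (auto simp: supp_def)
      then show "supp (grad i (u i) - grad i (v i)) \<subseteq> supp (a i)"
        by (simp add: sparse)
    qed
    also have "\<dots> \<le> (\<Sum>i\<in>UNIV. (1 + real (conflict_degree a i)) * (L * norm (u i - v i))\<^sup>2)"
      using lipschitz by (intro sum_mono mult_left_mono power_mono) (auto simp: lipschitz_on_def dist_norm)
    finally show ?thesis
      by (simp add: w_def sum_subtractf power_mult_distrib mult_ac)
  qed
  interpret weighted_smooth_objective F grad w Lbar \<mu> xstar
  proof
    show "GDERIV F y :> (\<Sum>i\<in>UNIV. grad i y)" for y
      unfolding F_def gderiv_def inner_sum_right
      using gradient by (intro has_derivative_sum) (simp add: gderiv_def)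
    show "F y + (\<Sum>i\<in>UNIV. grad i y) \<bullet> (z - y) \<le> F z" for y z
      using sum_mono[of UNIV, OF lower[of _ y z]] by (simp add: F_def inner_sum_left sum.distrib)
    show "continuous_on UNIV (grad i)" for i
      using lipschitz by (rule lipschitz_on_continuous_on)
    show "0 \<le> w i" for i
      by (simp add: w_def)
    show "F xstar \<le> F y" for y
      using minimizer by (simp add: is_arg_min_linorder)
  qed (use weighted sum_w Lbar_pos strong in auto)
  interpret prob_space M
    by (rule M)
  interpret delayed_quantized_descent F grad w Lbar \<mu> xstar M N Q \<xi> \<alpha> \<gamma> \<tau> delay x0 x
  proof
    show "\<gamma> * (\<alpha> * Lbar) \<le> 1"
      using step_small Lbar_pos \<alpha> by (simp add: field_simps)
  qed (use quantizer noise_indep noise_distr delays step iterates in auto)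
  have p_pos: "0 < p"
  proof -
    have "\<mu> * \<gamma> \<le> Lbar * \<gamma>"
      using \<mu>_le_\<Lambda> step(1) by simp
    also have "\<dots> \<le> \<alpha> * Lbar * \<gamma>"
      using \<alpha> Lbar_pos step(1) by simp
    also have "\<dots> < 1"
      using step_small Lbar_pos \<alpha> by (simp add: field_simps)
    finally show ?thesis
      by (simp add: p_def)
  qed
  have q_nonneg: "0 \<le> q"
    unfolding q_def using Lbar_pos step(1) \<alpha> \<mu>_pos by simp
  \<comment> \<open>The bound \<open>\<gamma> < \<mu> / (sqrt \<alpha> \<tau> Lbar\<^sup>2)\<close> is \<open>q < \<mu> \<gamma>\<close> in disguise.\<close>
  have "p + q \<le> 1"
  proof (cases "\<tau> = 0")
    case True
    then show ?thesis
      using \<mu>_pos step(1) by (simp add: p_def q_def)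
  next
    case False
    then have "\<gamma> < \<mu> / (sqrt \<alpha> * real \<tau> * Lbar\<^sup>2)"
      using step(2) by (simp add: max_step_def)
    then have "\<gamma> * (sqrt \<alpha> * real \<tau> * Lbar\<^sup>2) \<le> \<mu>"
      using False \<alpha> Lbar_pos by (simp add: field_simps)
    then have "(\<gamma> * (sqrt \<alpha> * real \<tau> * Lbar\<^sup>2))\<^sup>2 \<le> \<mu>\<^sup>2"
      using step(1) \<alpha> by (intro power_mono) auto
    then have "\<gamma> / \<mu> * (\<gamma>\<^sup>2 * \<alpha> * (real \<tau>)\<^sup>2 * Lbar ^ 4) \<le> \<gamma> / \<mu> * \<mu>\<^sup>2"
      using step(1) \<mu>_pos \<alpha> by (intro mult_left_mono) (simp_all add: power_mult_distrib)
    then show ?thesis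
      using \<mu>_pos by (simp add: p_def q_def power2_eq_square power3_eq_cube field_simps)
  qed
  moreover have "gap (Suc k) \<le> p * gap k + q * W"
    if "\<And>j. k - 2 * \<tau> \<le> j \<Longrightarrow> j \<le> k \<Longrightarrow> gap j \<le> W" for k W
    unfolding p_def q_def using that by (rule gap_Suc_le)
  ultimately have "gap k \<le> (p + q) powr (real k / (1 + real (2 * \<tau>))) * gap 0"
    using p_pos q_nonneg gap_nonneg[of 0] by (intro delayed_linear_recursion) auto
  then show ?thesis
    using integrable_gap[of k] by (simp add: gap_0) (simp add: gap_def)
qed

end
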